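(* Let $Z_1,\dots,Z_m$ be jointly normal random variables such that (A) $\mathbb E[Z_i]=0$ for all $i$ and $\mathbb E[Z_iZ_j]\le 0$ for all distinct $i,j\in\{1,\dots,m\}$, and (B) $\mathbb E[Z_i(Z_1+\cdots+Z_m)]\ge 0$ for all $i$. Let $\overline Z=(Z_1+\cdots+Z_m)/m$ and let $\mathcal C$ be the collection of events of the form $\bigcap_{i=1}^m\{Z_i\in[a_i,b_i]\}$ with $-\infty\le a_i\le b_i\le\infty$. Then for every $i\in\{1,\dots,m\}$, $\overline Z$ and $Z_i$ are positively associated given $\mathcal C$, i.e. for all $s,t\in\mathbb R$ and all $C\in\mathcal C$, \[ \mathbb P[\overline Z\ge s,\ Z_i\ge t\mid C]\ \ge\ \mathbb P[\overline Z\ge s\mid C]\,\mathbb P[Z_i\ge t\mid C]. \]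
   Context: Random variables $Z_1,\dots,Z_m$ are jointly normal if there exist independent normal random variables $Y_1,\dots,Y_n$ such that each $Z_i$ is a linear combination of the $Y_j$. A family satisfying (A) and (B) is called a repulsive–cooperative Gaussian ensemble. *)

theory Defs
  imports "HOL-Probability.Probability"
begin

(* Constants count as normal random variables of variance 0; the library density
   normal_density mu sigma only covers sigma > 0. *)
definition normal_rv :: "'a measure \<Rightarrow> ('a \<Rightarrow> real) \<Rightarrow> bool" where
  "normal_rv M X \<longleftrightarrow> X \<in> borel_measurable M \<and>
     ((\<exists>\<mu> \<sigma>. \<sigma> > 0 \<and> distributed M lborel X (normal_density \<mu> \<sigma>)) \<or>
      (\<exists>c. AE \<omega> in M. X \<omega> = c))"

(* Z 1, ..., Z m are jointly normal.  Equality of random variables is almost sure equality. *)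
definition jointly_normal :: "'a measure \<Rightarrow> nat \<Rightarrow> (nat \<Rightarrow> 'a \<Rightarrow> real) \<Rightarrow> bool" where
  "jointly_normal M m Z \<longleftrightarrow>
     (\<forall>i\<in>{1..m}. Z i \<in> borel_measurable M) \<and>
     (\<exists>(n::nat) (Y :: nat \<Rightarrow> 'a \<Rightarrow> real) (c :: nat \<Rightarrow> nat \<Rightarrow> real).
        (\<forall>j\<in>{1..n}. normal_rv M (Y j)) \<and>
        prob_space.indep_vars M (\<lambda>_. borel) Y {1..n} \<and>
        (\<forall>i\<in>{1..m}. AE \<omega> in M. Z i \<omega> = (\<Sum>j=1..n. c i j * Y j \<omega>)))"

definition box_events :: "'a measure \<Rightarrow> nat \<Rightarrow> (nat \<Rightarrow> 'a \<Rightarrow> real) \<Rightarrow> 'a set set" where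
  "box_events M m Z =
     {{\<omega> \<in> space M. \<forall>i\<in>{1..m}. a i \<le> ereal (Z i \<omega>) \<and> ereal (Z i \<omega>) \<le> b i} | a b.
        \<forall>i\<in>{1..m}. a i \<le> b i}"

(* Conditional probabilities are elementary ones, P(A \<inter> C) / P(C), so only events C of
   positive probability are conditioned on. *)
definition positively_associated_given ::
    "'a measure \<Rightarrow> ('a \<Rightarrow> real) \<Rightarrow> ('a \<Rightarrow> real) \<Rightarrow> 'a set set \<Rightarrow> bool" where
  "positively_associated_given M X Y \<C> \<longleftrightarrow>
     (\<forall>s t. \<forall>C\<in>\<C>. measure M C > 0 \<longrightarrow>
        \<P>(\<omega> in M. X \<omega> \<ge> s \<and> Y \<omega> \<ge> t \<bar> \<omega> \<in> C)
          \<ge> \<P>(\<omega> in M. X \<omega> \<ge> s \<bar> \<omega> \<in> C) * \<P>(\<omega> in M. Y \<omega> \<ge> t \<bar> \<omega> \<in> C))"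

end

theory Submission
  imports Defs
begin

text \<open>By induction on the number of variables. Write \<open>S\<close> for the sum. A rotation of the underlying
  white noise makes \<open>Z i\<close> a multiple of one coordinate, and \<open>Z k = W k - p k * Z i\<close> for the
  others, with \<open>W\<close> independent of \<open>Z i\<close>. Condition (A) says that \<open>p k \<ge> 0\<close> and that the
  covariances of \<open>W\<close> are again nonpositive off the diagonal; condition (B) says that
  \<open>(\<Sum>k. p k) \<le> 1\<close> and passes to \<open>W\<close>. Given \<open>Z i = x\<close>, the box constrains \<open>W k\<close> to an interval
  shifted by \<open>p k * x\<close>, and \<open>S = (\<Sum>k. W k) + (1 - (\<Sum>k. p k)) * x\<close>. By the induction hypothesis
  shifting the box of \<open>W\<close> upwards increases \<open>\<Sum>k. W k\<close> stochastically, so \<open>S\<close> is stochastically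
  increasing in \<open>x\<close>, and Chebyshev's inequality gives the association of \<open>S\<close> and \<open>Z i\<close>.\<close>

section \<open>Association within boxes\<close>

definition in_box :: "'i set \<Rightarrow> ('i \<Rightarrow> ereal) \<Rightarrow> ('i \<Rightarrow> ereal) \<Rightarrow> ('i \<Rightarrow> real) \<Rightarrow> bool" where
  "in_box I a b z \<longleftrightarrow> (\<forall>i\<in>I. a i \<le> ereal (z i) \<and> ereal (z i) \<le> b i)"

definition up_closed :: "real set \<Rightarrow> bool" where
  "up_closed B \<longleftrightarrow> (\<forall>x\<in>B. \<forall>y\<ge>x. y \<in> B)"

text \<open>Arbitrary up-closed sets instead of the half-lines \<open>{t..}\<close>, because \<open>box_mono\<close> also needs
  open half-lines and those with an infinite endpoint.\<close>

definition box_assoc :: "'a measure \<Rightarrow> 'i set \<Rightarrow> ('i \<Rightarrow> 'a \<Rightarrow> real) \<Rightarrow> 'i \<Rightarrow> bool" where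
  "box_assoc M I Z i \<longleftrightarrow> (\<forall>a b s B. B \<in> sets borel \<longrightarrow> up_closed B \<longrightarrow>
     \<P>(\<omega> in M. in_box I a b (\<lambda>k. Z k \<omega>) \<and> s \<le> (\<Sum>k\<in>I. Z k \<omega>)) *
     \<P>(\<omega> in M. in_box I a b (\<lambda>k. Z k \<omega>) \<and> Z i \<omega> \<in> B)
     \<le> \<P>(\<omega> in M. in_box I a b (\<lambda>k. Z k \<omega>) \<and> s \<le> (\<Sum>k\<in>I. Z k \<omega>) \<and> Z i \<omega> \<in> B) *
     \<P>(\<omega> in M. in_box I a b (\<lambda>k. Z k \<omega>)))"

lemma measurable_in_box [measurable (raw)]:
  assumes "finite I" "\<And>k. k \<in> I \<Longrightarrow> Z k \<in> borel_measurable M"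
  shows "Measurable.pred M (\<lambda>\<omega>. in_box I a b (\<lambda>k. Z k \<omega>))"
  unfolding in_box_def using assms by measurable

lemma box_assocD:
  assumes "box_assoc M I Z i" "B \<in> sets borel" "up_closed B"
  shows "\<P>(\<omega> in M. in_box I a b (\<lambda>k. Z k \<omega>) \<and> s \<le> (\<Sum>k\<in>I. Z k \<omega>)) *
     \<P>(\<omega> in M. in_box I a b (\<lambda>k. Z k \<omega>) \<and> Z i \<omega> \<in> B)
     \<le> \<P>(\<omega> in M. in_box I a b (\<lambda>k. Z k \<omega>) \<and> s \<le> (\<Sum>k\<in>I. Z k \<omega>) \<and> Z i \<omega> \<in> B) *
     \<P>(\<omega> in M. in_box I a b (\<lambda>k. Z k \<omega>))"
  using assms unfolding box_assoc_def by blast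

section \<open>Monotonicity of the conditional law of the sum in the box\<close>

text \<open>Transitivity of the chain \<open>n1 / d1 \<le> n2 / d2 \<le> n3 / d3\<close> of
  conditional probabilities, cross-multiplied so that null boxes are allowed. A null middle box
  would break the chain; the last hypothesis makes one of the outer boxes null in that case.\<close>

lemma ratio_le_trans:
  fixes n1 n2 n3 d1 d2 d3 :: real
  assumes "n1 * d2 \<le> n2 * d1" "n2 * d3 \<le> n3 * d2"
    and "0 \<le> n1" "0 \<le> n3" "n1 \<le> d1" "0 \<le> d2" "0 \<le> d3"
    and "d2 = 0 \<Longrightarrow> d1 = 0 \<or> d3 = 0"
  shows "n1 * d3 \<le> n3 * d1"
proof (cases "d2 = 0")
  case True
  have "0 \<le> n3 * d1" using assms by auto
  moreover have "n1 * d3 = 0" using True assms by auto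
  ultimately show ?thesis by linarith
next
  case False
  have "(n1 * d3) * d2 = (n1 * d2) * d3" by simp
  also have "\<dots> \<le> (n2 * d1) * d3" using assms by (intro mult_right_mono) auto
  also have "\<dots> = (n2 * d3) * d1" by simp
  also have "\<dots> \<le> (n3 * d2) * d1" using assms by (intro mult_right_mono) auto
  finally have "(n1 * d3) * d2 \<le> (n3 * d1) * d2" by (simp add: mult_ac)
  then show ?thesis using False assms by (simp add: mult_le_cancel_right)
qed

text \<open>Association of the sum with each coordinate says precisely that raising one end of one
  side of the box stochastically increases the sum; the sides are raised one at a time, passing
  through a box that contains both given ones.\<close>

lemma (in prob_space) box_mono:
  assumes fin: "finite I" and meas: "\<And>k. k \<in> I \<Longrightarrow> W k \<in> borel_measurable M"
    and assoc: "\<And>k. k \<in> I \<Longrightarrow> box_assoc M I W k"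
    and le: "\<And>k. k \<in> I \<Longrightarrow> a k \<le> a' k" "\<And>k. k \<in> I \<Longrightarrow> b k \<le> b' k"
  shows "\<P>(\<omega> in M. in_box I a b (\<lambda>k. W k \<omega>) \<and> s \<le> (\<Sum>k\<in>I. W k \<omega>)) *
     \<P>(\<omega> in M. in_box I a' b' (\<lambda>k. W k \<omega>))
     \<le> \<P>(\<omega> in M. in_box I a' b' (\<lambda>k. W k \<omega>) \<and> s \<le> (\<Sum>k\<in>I. W k \<omega>)) *
     \<P>(\<omega> in M. in_box I a b (\<lambda>k. W k \<omega>))"
proof -
  note [measurable] = fin meas
  define n where "n a b = \<P>(\<omega> in M. in_box I a b (\<lambda>k. W k \<omega>) \<and> s \<le> (\<Sum>k\<in>I. W k \<omega>))" for a b
  define d where "d a b = \<P>(\<omega> in M. in_box I a b (\<lambda>k. W k \<omega>))" for a b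
  have nonneg [simp]: "0 \<le> n a b" "0 \<le> d a b" for a b
    by (simp_all add: n_def d_def)
  have nd: "n a b \<le> d a b" for a b
    unfolding n_def d_def by (intro finite_measure_mono) auto
  have d_mono: "d a1 b1 \<le> d a2 b2" if "\<And>k. k \<in> I \<Longrightarrow> a2 k \<le> a1 k" "\<And>k. k \<in> I \<Longrightarrow> b1 k \<le> b2 k"
    for a1 a2 b1 b2
  proof -
    have "in_box I a2 b2 z" if "in_box I a1 b1 z" for z
      using that \<open>\<And>k. k \<in> I \<Longrightarrow> a2 k \<le> a1 k\<close> \<open>\<And>k. k \<in> I \<Longrightarrow> b1 k \<le> b2 k\<close>
      unfolding in_box_def by (meson order_trans)
    then show ?thesis
      unfolding d_def by (intro finite_measure_mono) auto
  qed
  have raise_upper: "n a b * d a (b(i := c)) \<le> n a (b(i := c)) * d a b"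
    if i: "i \<in> I" and c: "b i \<le> c" for a b i c
  proof -
    \<comment> \<open>The larger box is the reference: the smaller one is its part with
      \<open>W i\<close> outside \<open>B\<close>. Taking complements turns association in the
      larger box into the claim.\<close>
    define B where "B = {x. b i < ereal x}"
    have B: "B \<in> sets borel" "up_closed B"
      unfolding B_def up_closed_def by (auto intro: less_le_trans)
    note [measurable] = B(1)
    let ?C = "\<lambda>\<omega>. in_box I a (b(i := c)) (\<lambda>k. W k \<omega>)"
    have split: "in_box I a b (\<lambda>k. W k \<omega>) \<longleftrightarrow> ?C \<omega> \<and> W i \<omega> \<notin> B" for \<omega>
      using i c unfolding in_box_def B_def by (auto intro: order_trans)
    have "d a b = prob ({\<omega> \<in> space M. ?C \<omega>} - {\<omega> \<in> space M. ?C \<omega> \<and> W i \<omega> \<in> B})"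
      unfolding d_def split by (intro arg_cong[where f=prob]) auto
    also have "\<dots> = d a (b(i := c)) - \<P>(\<omega> in M. ?C \<omega> \<and> W i \<omega> \<in> B)"
      unfolding d_def using i by (intro finite_measure_Diff) auto
    finally have d: "d a b = d a (b(i := c)) - \<P>(\<omega> in M. ?C \<omega> \<and> W i \<omega> \<in> B)" .
    have "n a b = prob ({\<omega> \<in> space M. ?C \<omega> \<and> s \<le> (\<Sum>k\<in>I. W k \<omega>)} -
        {\<omega> \<in> space M. ?C \<omega> \<and> s \<le> (\<Sum>k\<in>I. W k \<omega>) \<and> W i \<omega> \<in> B})"
      unfolding n_def split by (intro arg_cong[where f=prob]) auto
    also have "\<dots> = n a (b(i := c)) - \<P>(\<omega> in M. ?C \<omega> \<and> s \<le> (\<Sum>k\<in>I. W k \<omega>) \<and> W i \<omega> \<in> B)"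
      unfolding n_def using i by (intro finite_measure_Diff) auto
    finally have n: "n a b = n a (b(i := c)) - \<P>(\<omega> in M. ?C \<omega> \<and> s \<le> (\<Sum>k\<in>I. W k \<omega>) \<and> W i \<omega> \<in> B)" .
    show ?thesis
      using box_assocD[OF assoc[OF i] B, of a "b(i := c)" s]
      unfolding n d by (simp add: n_def d_def algebra_simps)
  qed
  have raise_lower: "n a b * d (a(i := c)) b \<le> n (a(i := c)) b * d a b"
    if i: "i \<in> I" and c: "a i \<le> c" for a b i c
  proof -
    \<comment> \<open>Raising a lower end cuts the box down to the up-closed event
      \<open>W i \<in> B\<close>, so association in the original box is the claim itself.\<close>
    define B where "B = {x. c \<le> ereal x}"
    have B: "B \<in> sets borel" "up_closed B"
      unfolding B_def up_closed_def by (auto intro: order_trans)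
    have split: "in_box I (a(i := c)) b (\<lambda>k. W k \<omega>) \<longleftrightarrow> in_box I a b (\<lambda>k. W k \<omega>) \<and> W i \<omega> \<in> B" for \<omega>
      using i c unfolding in_box_def B_def by (auto intro: order_trans)
    show ?thesis
      using box_assocD[OF assoc[OF i] B, of a b s]
      unfolding n_def d_def split by (simp add: conj_ac)
  qed
  \<comment> \<open>\<open>F\<close> is the set of coordinates whose upper end has been raised so
    far.\<close>
  have upper: "F \<subseteq> I \<Longrightarrow> n a b * d a (\<lambda>k. if k \<in> F then b' k else b k) \<le>
      n a (\<lambda>k. if k \<in> F then b' k else b k) * d a b" if "finite F" for F
    using that
  proof (induction F)
    case (insert i F)
    let ?b = "\<lambda>k. if k \<in> F then b' k else b k"
    have eq: "(\<lambda>k. if k \<in> insert i F then b' k else b k) = ?b(i := b' i)" by auto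
    \<comment> \<open>The boxes grow along this chain, so a null intermediate box forces the initial
      one to be null, as \<open>ratio_le_trans\<close> demands.\<close>
    have "d a b \<le> d a ?b" by (intro d_mono) (use insert.prems le in auto)
    then show ?case
      unfolding eq
      using insert.IH insert.prems insert.hyps le nd nonneg
      by (intro ratio_le_trans[OF _ raise_upper]) (auto intro: antisym)
  qed simp
  have lower: "F \<subseteq> I \<Longrightarrow> n a b' * d (\<lambda>k. if k \<in> F then a' k else a k) b' \<le>
      n (\<lambda>k. if k \<in> F then a' k else a k) b' * d a b'" if "finite F" for F
    using that
  proof (induction F)
    case (insert i F)
    let ?a = "\<lambda>k. if k \<in> F then a' k else a k"
    have eq: "(\<lambda>k. if k \<in> insert i F then a' k else a k) = ?a(i := a' i)" by auto
    \<comment> \<open>Here the boxes shrink, so a null intermediate box forces the next one to be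
      null.\<close>
    have "d (?a(i := a' i)) b' \<le> d ?a b'" by (intro d_mono) (use insert.prems insert.hyps le in auto)
    then show ?case
      unfolding eq
      using insert.IH insert.prems insert.hyps le nd nonneg
      by (intro ratio_le_trans[OF _ raise_lower]) (auto intro: antisym)
  qed simp
  have "n a b * d a' b' \<le> n a' b' * d a b"
  proof (rule ratio_le_trans)
    show "n a b * d a b' \<le> n a b' * d a b"
      using upper[OF fin] by (simp add: n_def d_def in_box_def)
    show "n a b' * d a' b' \<le> n a' b' * d a b'"
      using lower[OF fin] by (simp add: n_def d_def in_box_def)
    have "d a b \<le> d a b'" by (intro d_mono) (use le in auto)
    then show "d a b = 0 \<or> d a' b' = 0" if "d a b' = 0" using that nonneg(2)[of a b] by simp
  qed (use nd in auto)
  then show ?thesis by (simp add: n_def d_def)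
qed

section \<open>Chebyshev's inequality on a product space\<close>

text \<open>Each product of integrals is an iterated integral over two copies of the variable; the
  copies are exchanged on the right, which leaves a pointwise comparison.\<close>

lemma nn_integral_mult_le_cross:
  assumes [measurable]: "f \<in> borel_measurable N" "g \<in> borel_measurable N"
    "f' \<in> borel_measurable N" "g' \<in> borel_measurable N"
    and le: "\<And>x y. x \<in> space N \<Longrightarrow> y \<in> space N \<Longrightarrow> f x * g y \<le> f' y * g' x"
  shows "(\<integral>\<^sup>+x. f x \<partial>N) * (\<integral>\<^sup>+x. g x \<partial>N) \<le> (\<integral>\<^sup>+x. f' x \<partial>N) * (\<integral>\<^sup>+x. g' x \<partial>N)"
proof -
  have "(\<integral>\<^sup>+x. f x \<partial>N) * (\<integral>\<^sup>+y. g y \<partial>N) = (\<integral>\<^sup>+y. (\<integral>\<^sup>+x. f x * g y \<partial>N) \<partial>N)"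
    by (simp add: nn_integral_cmult nn_integral_multc)
  also have "\<dots> \<le> (\<integral>\<^sup>+y. (\<integral>\<^sup>+x. f' y * g' x \<partial>N) \<partial>N)"
    by (intro nn_integral_mono le)
  also have "\<dots> = (\<integral>\<^sup>+y. f' y \<partial>N) * (\<integral>\<^sup>+x. g' x \<partial>N)"
    by (simp add: nn_integral_cmult nn_integral_multc)
  finally show ?thesis .
qed

lemma (in sigma_finite_measure) emeasure_pair_Collect:
  assumes "Measurable.pred (N \<Otimes>\<^sub>M M) P"
  shows "emeasure (N \<Otimes>\<^sub>M M) {\<omega> \<in> space (N \<Otimes>\<^sub>M M). P \<omega>} =
      (\<integral>\<^sup>+x. emeasure M {y \<in> space M. P (x, y)} \<partial>N)" (is ?eq)
    and "(\<lambda>x. emeasure M {y \<in> space M. P (x, y)}) \<in> borel_measurable N" (is ?meas)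
proof -
  let ?S = "{\<omega> \<in> space (N \<Otimes>\<^sub>M M). P \<omega>}"
  have S: "?S \<in> sets (N \<Otimes>\<^sub>M M)" using assms by simp
  have eq: "Pair x -` ?S = {y \<in> space M. P (x, y)}" if "x \<in> space N" for x
    using that by (auto simp: space_pair_measure)
  show ?eq
    unfolding emeasure_pair_measure_alt[OF S] by (intro nn_integral_cong) (simp only: eq)
  show ?meas
    by (subst measurable_cong[of _ _ "\<lambda>x. emeasure M (Pair x -` ?S)"])
      (simp_all only: eq measurable_emeasure_Pair[OF S])
qed

text \<open>The inductive step, with independence expressed by the product measure. Only pairs of
  points on opposite sides of \<open>B\<close> need comparing, and there \<open>up_closed\<close>
  orders the values of \<open>X\<close>: the larger value shifts the box of \<open>W\<close> upwards
  and does not raise the threshold for its sum.\<close>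

lemma box_assoc_pair:
  fixes W :: "'i \<Rightarrow> 'b \<Rightarrow> real" and X :: "'a \<Rightarrow> real" and p :: "'i \<Rightarrow> real"
  assumes "prob_space N" "prob_space M" "finite I" "i \<notin> I"
    and X [measurable]: "X \<in> borel_measurable N"
    and W [measurable]: "\<And>k. k \<in> I \<Longrightarrow> W k \<in> borel_measurable M"
    and assoc: "\<And>k. k \<in> I \<Longrightarrow> box_assoc M I W k"
    and p: "\<And>k. k \<in> I \<Longrightarrow> 0 \<le> p k" "(\<Sum>k\<in>I. p k) \<le> 1"
  shows "box_assoc (N \<Otimes>\<^sub>M M) (insert i I)
    (\<lambda>k (x, y). if k = i then X x else W k y - p k * X x) i"
proof -
  interpret N: prob_space N by fact
  interpret M: prob_space M by fact
  interpret NM: pair_prob_space N M ..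
  note [measurable] = \<open>finite I\<close>
  let ?Z = "\<lambda>k (x, y). if k = i then X x else W k y - p k * X x"
  have ereal_le_diff: "u \<le> ereal (w - c) \<longleftrightarrow> u + ereal c \<le> ereal w"
    "ereal (w - c) \<le> u \<longleftrightarrow> ereal w \<le> u + ereal c" for u w c
    by (cases u; auto)+
  show ?thesis
    unfolding box_assoc_def
  proof (intro allI impI)
    fix a b s B
    assume B [measurable]: "B \<in> sets borel" and up: "up_closed B"
    \<comment> \<open>\<open>A\<close> is the event about the total sum, rewritten as a threshold
      for the sum of \<open>W\<close>. \<open>T\<close> is the side of the box that constrains
      \<open>X\<close>, and \<open>D\<close> consists of the other sides with the shift moved to the
      endpoints.\<close>
    define A where "A x y \<longleftrightarrow> s - (1 - (\<Sum>k\<in>I. p k)) * X x \<le> (\<Sum>k\<in>I. W k y)" for x y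
    define T where "T x \<longleftrightarrow> a i \<le> ereal (X x) \<and> ereal (X x) \<le> b i" for x
    define D where "D x y \<longleftrightarrow> in_box I (\<lambda>k. a k + ereal (p k * X x))
      (\<lambda>k. b k + ereal (p k * X x)) (\<lambda>k. W k y)" for x y
    have D_alt: "D x y \<longleftrightarrow> in_box I a b (\<lambda>k. W k y - p k * X x)" for x y
      unfolding D_def in_box_def ereal_le_diff ..
    have box: "in_box (insert i I) a b (\<lambda>k. ?Z k \<omega>) \<longleftrightarrow> T (fst \<omega>) \<and> D (fst \<omega>) (snd \<omega>)" for \<omega>
      using \<open>i \<notin> I\<close> unfolding D_alt T_def in_box_def by (cases \<omega>) auto
    have "(\<Sum>k\<in>insert i I. ?Z k (x, y)) = X x + (\<Sum>k\<in>I. W k y - p k * X x)" for x y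
      using \<open>i \<notin> I\<close> \<open>finite I\<close> by (auto intro!: sum.cong)
    then have "(\<Sum>k\<in>insert i I. ?Z k (x, y)) = (\<Sum>k\<in>I. W k y) + (1 - (\<Sum>k\<in>I. p k)) * X x" for x y
      by (simp only: sum_subtractf sum_distrib_right[symmetric]) (simp add: algebra_simps)
    then have sum: "s \<le> (\<Sum>k\<in>insert i I. ?Z k \<omega>) \<longleftrightarrow> A (fst \<omega>) (snd \<omega>)" for \<omega>
      unfolding A_def by (cases \<omega>) (simp only: fst_conv snd_conv diff_le_eq)
    have [measurable]: "Measurable.pred (N \<Otimes>\<^sub>M M) (\<lambda>\<omega>. A (fst \<omega>) (snd \<omega>))"
      "Measurable.pred N T"
      unfolding A_def T_def by measurable
    have [measurable]: "Measurable.pred (N \<Otimes>\<^sub>M M) (\<lambda>\<omega>. D (fst \<omega>) (snd \<omega>))"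
      unfolding D_alt by measurable
    have [measurable]: "Measurable.pred M (\<lambda>y. A x y)" "Measurable.pred M (\<lambda>y. D x y)" for x
      unfolding A_def D_def by measurable
    define \<mu> where "\<mu> P = \<P>(\<omega> in N \<Otimes>\<^sub>M M. T (fst \<omega>) \<and> D (fst \<omega>) (snd \<omega>) \<and> P \<omega>)" for P
    let ?A = "\<lambda>\<omega>. A (fst \<omega>) (snd \<omega>)" and ?B = "\<lambda>\<omega>. X (fst \<omega>) \<in> B"
    \<comment> \<open>Association is equivalent to this inequality between the parts inside and
      outside \<open>B\<close>, which has the form needed for the cross comparison of
      integrals.\<close>
    have "emeasure (N \<Otimes>\<^sub>M M) {\<omega> \<in> space (N \<Otimes>\<^sub>M M). T (fst \<omega>) \<and> D (fst \<omega>) (snd \<omega>) \<and> ?A \<omega> \<and> \<not> ?B \<omega>} *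
        emeasure (N \<Otimes>\<^sub>M M) {\<omega> \<in> space (N \<Otimes>\<^sub>M M). T (fst \<omega>) \<and> D (fst \<omega>) (snd \<omega>) \<and> ?B \<omega>}
      \<le> emeasure (N \<Otimes>\<^sub>M M) {\<omega> \<in> space (N \<Otimes>\<^sub>M M). T (fst \<omega>) \<and> D (fst \<omega>) (snd \<omega>) \<and> ?A \<omega> \<and> ?B \<omega>} *
        emeasure (N \<Otimes>\<^sub>M M) {\<omega> \<in> space (N \<Otimes>\<^sub>M M). T (fst \<omega>) \<and> D (fst \<omega>) (snd \<omega>) \<and> \<not> ?B \<omega>}"
    proof (subst (1 2 3 4) M.emeasure_pair_Collect, (measurable)[4], rule nn_integral_mult_le_cross)
      fix x x'
      assume "x \<in> space N" "x' \<in> space N"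
      show "emeasure M {y \<in> space M. T (fst (x, y)) \<and> D (fst (x, y)) (snd (x, y)) \<and> ?A (x, y) \<and> \<not> ?B (x, y)} *
          emeasure M {y \<in> space M. T (fst (x', y)) \<and> D (fst (x', y)) (snd (x', y)) \<and> ?B (x', y)}
        \<le> emeasure M {y \<in> space M. T (fst (x', y)) \<and> D (fst (x', y)) (snd (x', y)) \<and> ?A (x', y) \<and> ?B (x', y)} *
          emeasure M {y \<in> space M. T (fst (x, y)) \<and> D (fst (x, y)) (snd (x, y)) \<and> \<not> ?B (x, y)}"
      \<comment> \<open>In every other case one factor on the left is the measure of an empty
        set.\<close>
      proof (cases "T x \<and> T x' \<and> X x \<notin> B \<and> X x' \<in> B")
        case True
        have lt: "X x \<le> X x'"
          using True up unfolding up_closed_def by (meson linear)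
        \<comment> \<open>The box moves first, at the threshold belonging to \<open>x\<close>; the
          threshold moves afterwards.\<close>
        have "\<P>(y in M. D x y \<and> A x y) * \<P>(y in M. D x' y) \<le> \<P>(y in M. D x' y \<and> A x y) * \<P>(y in M. D x y)"
          unfolding D_def A_def
          by (rule M.box_mono) (use \<open>finite I\<close> assoc p lt in \<open>auto intro!: add_left_mono mult_left_mono\<close>)
        also have "\<dots> \<le> \<P>(y in M. D x' y \<and> A x' y) * \<P>(y in M. D x y)"
        proof (intro mult_right_mono M.finite_measure_mono)
          have "(1 - (\<Sum>k\<in>I. p k)) * X x \<le> (1 - (\<Sum>k\<in>I. p k)) * X x'"
            using p lt by (intro mult_left_mono) auto
          then show "{y \<in> space M. D x' y \<and> A x y} \<subseteq> {y \<in> space M. D x' y \<and> A x' y}"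
            unfolding A_def by auto
        qed auto
        finally show ?thesis
          using True by (simp add: M.emeasure_eq_measure flip: ennreal_mult)
      qed auto
    qed (rule M.emeasure_pair_Collect, measurable)+
    then have cross: "\<mu> (\<lambda>\<omega>. ?A \<omega> \<and> \<not> ?B \<omega>) * \<mu> ?B \<le> \<mu> (\<lambda>\<omega>. ?A \<omega> \<and> ?B \<omega>) * \<mu> (\<lambda>\<omega>. \<not> ?B \<omega>)"
      unfolding \<mu>_def by (simp add: NM.emeasure_eq_measure flip: ennreal_mult)
    have split: "\<mu> P = \<mu> (\<lambda>\<omega>. P \<omega> \<and> ?B \<omega>) + \<mu> (\<lambda>\<omega>. P \<omega> \<and> \<not> ?B \<omega>)"
      if [measurable]: "Measurable.pred (N \<Otimes>\<^sub>M M) P" for P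
      unfolding \<mu>_def
      by (subst NM.finite_measure_Union[symmetric]) (auto intro!: arg_cong[where f="measure _"])
    \<comment> \<open>The common term, the mass of \<open>?A\<close> and \<open>?B\<close> jointly
      times the mass of \<open>?B\<close>, is added to both sides of \<open>cross\<close>.\<close>
    have "\<mu> ?A * \<mu> ?B \<le> \<mu> (\<lambda>\<omega>. ?A \<omega> \<and> ?B \<omega>) * \<mu> (\<lambda>_. True)"
      using cross split[of ?A] split[of "\<lambda>_. True"] by (simp add: algebra_simps)
    then show "\<P>(\<omega> in N \<Otimes>\<^sub>M M. in_box (insert i I) a b (\<lambda>k. ?Z k \<omega>) \<and> s \<le> (\<Sum>k\<in>insert i I. ?Z k \<omega>)) *
         \<P>(\<omega> in N \<Otimes>\<^sub>M M. in_box (insert i I) a b (\<lambda>k. ?Z k \<omega>) \<and> ?Z i \<omega> \<in> B)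
       \<le> \<P>(\<omega> in N \<Otimes>\<^sub>M M. in_box (insert i I) a b (\<lambda>k. ?Z k \<omega>) \<and> s \<le> (\<Sum>k\<in>insert i I. ?Z k \<omega>) \<and> ?Z i \<omega> \<in> B) *
         \<P>(\<omega> in N \<Otimes>\<^sub>M M. in_box (insert i I) a b (\<lambda>k. ?Z k \<omega>))"
      unfolding box sum \<mu>_def by (simp add: split_beta)
  qed
qed

section \<open>Standard Gaussian vectors\<close>

definition std_normal :: "real measure" where
  "std_normal = density lborel std_normal_density"

definition std_gauss :: "'j set \<Rightarrow> ('j \<Rightarrow> real) measure" where
  "std_gauss J = (\<Pi>\<^sub>M j\<in>J. std_normal)"

definition dot :: "'j set \<Rightarrow> ('j \<Rightarrow> real) \<Rightarrow> ('j \<Rightarrow> real) \<Rightarrow> real" where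
  "dot J u x = (\<Sum>j\<in>J. u j * x j)"

lemma sets_std_normal [simp, measurable_cong]: "sets std_normal = sets borel"
  by (simp add: std_normal_def)

lemma space_std_normal [simp]: "space std_normal = UNIV"
  by (simp add: std_normal_def)

lemma prob_space_std_normal: "prob_space std_normal"
  unfolding std_normal_def by (rule prob_space_normal_density) simp

lemma prob_space_std_gauss: "prob_space (std_gauss J)"
  unfolding std_gauss_def by (intro prob_space_PiM prob_space_std_normal)

lemma sets_std_gauss [measurable_cong]: "sets (std_gauss J) = sets (\<Pi>\<^sub>M j\<in>J. borel)"
  unfolding std_gauss_def by (intro sets_PiM_cong) auto

lemma measurable_dot_std_gauss [measurable]: "dot J u \<in> borel_measurable (std_gauss J)"
  unfolding dot_def by measurable

section \<open>Rotation invariance of white noise\<close>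

text \<open>The planar Gaussian density depends only on the distance to the origin. The rotation is
  undone by two one-dimensional affine substitutions, one in the inner variable and, after Fubini,
  one in the other; their Jacobians cancel, and \<open>c \<noteq> 0\<close> makes both
  invertible.\<close>

lemma nn_integral_std_normal_rotate:
  fixes c s :: real
  assumes [measurable]: "case_prod f \<in> borel_measurable (borel \<Otimes>\<^sub>M borel)"
    and cs: "c\<^sup>2 + s\<^sup>2 = 1" "c \<noteq> 0"
  shows "(\<integral>\<^sup>+y. \<integral>\<^sup>+x. f (c * x + s * y) (c * y - s * x) \<partial>std_normal \<partial>std_normal) =
    (\<integral>\<^sup>+y. \<integral>\<^sup>+x. f x y \<partial>std_normal \<partial>std_normal)"
proof -
  let ?\<phi> = "\<lambda>x. ennreal (std_normal_density x)"
  define h where "h x y = ?\<phi> y * (?\<phi> x * f x y)" for x y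
  have [measurable]: "case_prod h \<in> borel_measurable (borel \<Otimes>\<^sub>M borel)"
    unfolding h_def by measurable
  have as_h: "(\<integral>\<^sup>+y. \<integral>\<^sup>+x. g x y \<partial>std_normal \<partial>std_normal) =
      (\<integral>\<^sup>+y. \<integral>\<^sup>+x. ?\<phi> y * (?\<phi> x * g x y) \<partial>lborel \<partial>lborel)"
    if [measurable]: "case_prod g \<in> borel_measurable (borel \<Otimes>\<^sub>M borel)" for g
    unfolding std_normal_def by (simp add: nn_integral_density nn_integral_cmult)
  have density: "?\<phi> y * ?\<phi> x = ?\<phi> (c * y - s * x) * ?\<phi> (c * x + s * y)" for x y
  proof -
    have "(c * y - s * x)\<^sup>2 + (c * x + s * y)\<^sup>2 = (c\<^sup>2 + s\<^sup>2) * (x\<^sup>2 + y\<^sup>2)"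
      by (simp add: power2_eq_square algebra_simps)
    then have "(c * y - s * x)\<^sup>2 / 2 + (c * x + s * y)\<^sup>2 / 2 = y\<^sup>2 / 2 + x\<^sup>2 / 2"
      using cs by simp
    then have "exp (- y\<^sup>2 / 2) * exp (- x\<^sup>2 / 2) =
        exp (- (c * y - s * x)\<^sup>2 / 2) * exp (- (c * x + s * y)\<^sup>2 / 2)"
      unfolding exp_add[symmetric] by (intro arg_cong[where f=exp]) linarith
    then show ?thesis
      by (simp add: normal_density_def flip: ennreal_mult)
  qed
  have inner: "(\<integral>\<^sup>+x. h (c * x + s * y) (c * y - s * x) \<partial>lborel) =
      ennreal \<bar>1 / c\<bar> * (\<integral>\<^sup>+u. h u ((y - s * u) / c) \<partial>lborel)" for y
  proof -
    have "c * (- s * y / c + 1 / c * u) + s * y = u" for u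
      using cs by (simp add: field_simps)
    moreover have "c * y - s * (- s * y / c + 1 / c * u) = (y - s * u) / c" for u
    proof -
      have "c * y - s * (- s * y / c + 1 / c * u) = ((c\<^sup>2 + s\<^sup>2) * y - s * u) / c"
        using cs(2) by (simp add: field_simps power2_eq_square)
      then show ?thesis using cs by simp
    qed
    ultimately show ?thesis
      by (subst nn_integral_real_affine[of _ "1 / c" "- s * y / c"]) (use cs in simp_all)
  qed
  have outer: "ennreal \<bar>1 / c\<bar> * (\<integral>\<^sup>+y. h u ((y - s * u) / c) \<partial>lborel) = (\<integral>\<^sup>+y. h u y \<partial>lborel)" for u
  proof -
    have "- s * u / c + 1 / c * y = (y - s * u) / c" for y
      by (simp add: diff_divide_distrib)
    then show ?thesis
      by (subst (2) nn_integral_real_affine[of _ "1 / c" "- s * u / c"]) (use cs in simp_all)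
  qed
  have "(\<integral>\<^sup>+y. \<integral>\<^sup>+x. f (c * x + s * y) (c * y - s * x) \<partial>std_normal \<partial>std_normal) =
      (\<integral>\<^sup>+y. \<integral>\<^sup>+x. h (c * x + s * y) (c * y - s * x) \<partial>lborel \<partial>lborel)"
    by (subst as_h, measurable, intro nn_integral_cong)
      (simp only: h_def mult.assoc[symmetric] density[symmetric])
  also have "\<dots> = (\<integral>\<^sup>+y. \<integral>\<^sup>+u. ennreal \<bar>1 / c\<bar> * h u ((y - s * u) / c) \<partial>lborel \<partial>lborel)"
    unfolding inner by (simp add: nn_integral_cmult)
  also have "\<dots> = (\<integral>\<^sup>+u. \<integral>\<^sup>+y. ennreal \<bar>1 / c\<bar> * h u ((y - s * u) / c) \<partial>lborel \<partial>lborel)"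
    by (rule lborel_pair.Fubini') measurable
  also have "\<dots> = (\<integral>\<^sup>+u. \<integral>\<^sup>+y. h u y \<partial>lborel \<partial>lborel)"
    by (subst nn_integral_cmult, measurable) (simp only: outer)
  also have "\<dots> = (\<integral>\<^sup>+y. \<integral>\<^sup>+u. h u y \<partial>lborel \<partial>lborel)"
    by (rule lborel_pair.Fubini') measurable
  also have "\<dots> = (\<integral>\<^sup>+y. \<integral>\<^sup>+x. f x y \<partial>std_normal \<partial>std_normal)"
    by (subst as_h) (simp_all add: h_def)
  finally show ?thesis .
qed

text \<open>For \<open>c\<^sup>2 + s\<^sup>2 = 1\<close> and distinct \<open>j\<close>,
  \<open>k\<close> this is a Givens rotation; both new entries are computed from the old
  \<open>x\<close>, and \<open>- s\<close> gives the inverse.\<close>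

definition rotate_coords :: "'j \<Rightarrow> 'j \<Rightarrow> real \<Rightarrow> real \<Rightarrow> ('j \<Rightarrow> real) \<Rightarrow> 'j \<Rightarrow> real" where
  "rotate_coords j k c s x = x(k := c * x k - s * x j, j := c * x j + s * x k)"

lemma measurable_rotate_coords:
  assumes "j \<in> J" "k \<in> J"
  shows "rotate_coords j k c s \<in> measurable (std_gauss J) (std_gauss J)"
proof -
  \<comment> \<open>\<open>measurable_fun_upd\<close> enlarges the index set by the updated
    coordinate, which here already belongs to it.\<close>
  have J: "J = J \<union> {k}" "J = J \<union> {j}" using assms by auto
  have [measurable]: "(\<lambda>x. x j) \<in> borel_measurable (std_gauss J)" "(\<lambda>x. x k) \<in> borel_measurable (std_gauss J)"
    using assms by measurable
  have id: "(\<lambda>x. x) \<in> measurable (std_gauss J) (Pi\<^sub>M J (\<lambda>_. borel))"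
    by measurable
  have "(\<lambda>x. c * x k - s * x j) \<in> borel_measurable (std_gauss J)"
    "(\<lambda>x. c * x j + s * x k) \<in> borel_measurable (std_gauss J)"
    by measurable
  then have "rotate_coords j k c s \<in> measurable (std_gauss J) (Pi\<^sub>M J (\<lambda>_. borel))"
    unfolding rotate_coords_def[abs_def]
    by (intro measurable_fun_upd[OF J(2) measurable_fun_upd[OF J(1) id]])
  then show ?thesis by (simp cong: measurable_cong_sets add: sets_std_gauss)
qed

text \<open>Fubini splits off the coordinates \<open>j\<close> and \<open>k\<close>; with the
  remaining ones fixed, the planar rotation acts on the two inner integrals.\<close>

lemma distr_std_gauss_rotate:
  assumes J: "finite J" "j \<in> J" "k \<in> J" "j \<noteq> k" and cs: "c\<^sup>2 + s\<^sup>2 = 1" "c \<noteq> 0"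
  shows "distr (std_gauss J) (std_gauss J) (rotate_coords j k c s) = std_gauss J"
proof (rule measure_eqI)
  interpret std_normal: prob_space std_normal by (rule prob_space_std_normal)
  interpret P: product_sigma_finite "\<lambda>_. std_normal" ..
  note [measurable] = measurable_rotate_coords[OF J(2,3)]
  define K where "K = J - {j, k}"
  have K: "finite K" "k \<notin> K" "j \<notin> insert k K" "J = insert j (insert k K)"
    using J by (auto simp: K_def)
  have nn: "(\<integral>\<^sup>+x. F x \<partial>std_gauss J) =
      (\<integral>\<^sup>+x. \<integral>\<^sup>+y. \<integral>\<^sup>+z. F (x(k := y, j := z)) \<partial>std_normal \<partial>std_normal \<partial>std_gauss K)"
    if F [measurable]: "F \<in> borel_measurable (std_gauss J)" for F
  proof -
    have [measurable]: "F \<in> borel_measurable (\<Pi>\<^sub>M j\<in>insert j (insert k K). std_normal)"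
      using F unfolding std_gauss_def K(4) .
    show ?thesis
      unfolding std_gauss_def K(4)
      using K by (simp add: P.product_nn_integral_insert)
  qed
  fix A assume "A \<in> sets (distr (std_gauss J) (std_gauss J) (rotate_coords j k c s))"
  then have A [measurable]: "A \<in> sets (std_gauss J)" by simp
  have upd: "rotate_coords j k c s (x(k := y, j := z)) = x(k := c * y - s * z, j := c * z + s * y)" for x y z
    using \<open>j \<noteq> k\<close> by (auto simp: rotate_coords_def)
  have "emeasure (distr (std_gauss J) (std_gauss J) (rotate_coords j k c s)) A =
      (\<integral>\<^sup>+x. indicator A (rotate_coords j k c s x) \<partial>std_gauss J)"
    using nn_integral_distr[of "rotate_coords j k c s" "std_gauss J" "std_gauss J" "indicator A"] by simp
  also have "\<dots> = (\<integral>\<^sup>+x. \<integral>\<^sup>+y. \<integral>\<^sup>+z. indicator A (x(k := c * y - s * z, j := c * z + s * y)) \<partial>std_normal \<partial>std_normal \<partial>std_gauss K)"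
    by (subst nn) (simp_all add: upd)
  also have "\<dots> = (\<integral>\<^sup>+x. \<integral>\<^sup>+y. \<integral>\<^sup>+z. indicator A (x(k := y, j := z)) \<partial>std_normal \<partial>std_normal \<partial>std_gauss K)"
  proof (rule nn_integral_cong)
    fix x assume "x \<in> space (std_gauss K)"
    then have [measurable]: "(\<lambda>_. x) \<in> measurable (borel \<Otimes>\<^sub>M borel) (Pi\<^sub>M K (\<lambda>_. borel))"
      unfolding std_gauss_def by (simp add: space_PiM)
    have "(\<lambda>p::real \<times> real. x(k := snd p, j := fst p)) \<in> measurable (borel \<Otimes>\<^sub>M borel) (Pi\<^sub>M J (\<lambda>_. borel))"
    proof (rule measurable_fun_upd[where J="insert k K"])
      show "(\<lambda>p. x(k := snd p)) \<in> measurable (borel \<Otimes>\<^sub>M borel) (Pi\<^sub>M (insert k K) (\<lambda>_. borel))"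
        by (rule measurable_fun_upd[where J=K]) auto
    qed (use K in auto)
    then have "(\<lambda>p::real \<times> real. x(k := snd p, j := fst p)) \<in> measurable (borel \<Otimes>\<^sub>M borel) (std_gauss J)"
      by (simp cong: measurable_cong_sets add: sets_std_gauss)
    then have "(\<lambda>(z, y). indicator A (x(k := y, j := z)) :: ennreal) \<in> borel_measurable (borel \<Otimes>\<^sub>M borel)"
      unfolding split_beta by measurable
    then show "(\<integral>\<^sup>+y. \<integral>\<^sup>+z. indicator A (x(k := c * y - s * z, j := c * z + s * y)) \<partial>std_normal \<partial>std_normal) =
        (\<integral>\<^sup>+y. \<integral>\<^sup>+z. indicator A (x(k := y, j := z)) \<partial>std_normal \<partial>std_normal)"
      by (rule nn_integral_std_normal_rotate[OF _ cs])
  qed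
  also have "\<dots> = emeasure (std_gauss J) A"
    by (subst nn[symmetric]) simp_all
  finally show "emeasure (distr (std_gauss J) (std_gauss J) (rotate_coords j k c s)) A = emeasure (std_gauss J) A" .
qed simp

text \<open>The transpose of a rotation is the rotation by the opposite angle, so a rotation of the
  noise can be moved to the coefficients.\<close>

lemma dot_rotate_coords:
  assumes "finite J" "j \<in> J" "k \<in> J" "j \<noteq> k"
  shows "dot J u (rotate_coords j k c s x) = dot J (rotate_coords j k c (- s) u) x"
proof -
  define K where "K = J - {j, k}"
  have K: "finite K" "k \<notin> K" "j \<notin> insert k K" "J = insert j (insert k K)"
    using assms by (auto simp: K_def)
  have "(\<Sum>i\<in>K. u i * rotate_coords j k c s x i) = (\<Sum>i\<in>K. rotate_coords j k c (- s) u i * x i)"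
    using K by (intro sum.cong) (auto simp: rotate_coords_def)
  then show ?thesis
    using K \<open>j \<noteq> k\<close> unfolding dot_def K(4) by (simp add: rotate_coords_def algebra_simps)
qed

text \<open>Rotating all coefficient vectors preserves their Gram matrix, hence all
  covariances.\<close>

lemma dot_rotate_coords_both:
  assumes J: "finite J" "j \<in> J" "k \<in> J" "j \<noteq> k" and cs: "c\<^sup>2 + s\<^sup>2 = 1"
  shows "dot J (rotate_coords j k c s u) (rotate_coords j k c s x) = dot J u x"
proof -
  have "c * (c * a - s * b) + s * (c * b + s * a) = a" "c * (c * a + s * b) - s * (c * b - s * a) = a" for a b
    using cs by algebra+
  then have "rotate_coords j k c (- s) (rotate_coords j k c s u) = u"
    using \<open>j \<noteq> k\<close> by (auto simp: rotate_coords_def fun_eq_iff)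
  then show ?thesis by (simp add: dot_rotate_coords[OF J])
qed

section \<open>Transport of association along maps and rotations\<close>

text \<open>Association concerns only the joint law of the family. This permits replacing the given
  probability space by white noise and rotating that noise.\<close>

lemma box_assoc_distr:
  assumes [measurable]: "f \<in> measurable M N" "finite I" "\<And>k. k \<in> I \<Longrightarrow> Z k \<in> borel_measurable N"
    and i: "i \<in> I"
  shows "box_assoc (distr M N f) I Z i \<longleftrightarrow> box_assoc M I (\<lambda>k \<omega>. Z k (f \<omega>)) i"
proof -
  have prob: "\<P>(\<omega> in distr M N f. P \<omega>) = \<P>(\<omega> in M. P (f \<omega>))" if "Measurable.pred N P" for P
    using that measurable_space[OF assms(1)]
    by (subst measure_distr) (auto intro!: arg_cong[where f="measure M"])
  note [measurable] = i
  show ?thesis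
    unfolding box_assoc_def
  proof (intro all_cong1 imp_cong refl)
    fix a b s and B :: "real set"
    assume [measurable]: "B \<in> sets borel"
    show "(\<P>(\<omega> in distr M N f. in_box I a b (\<lambda>k. Z k \<omega>) \<and> s \<le> (\<Sum>k\<in>I. Z k \<omega>)) *
       \<P>(\<omega> in distr M N f. in_box I a b (\<lambda>k. Z k \<omega>) \<and> Z i \<omega> \<in> B)
       \<le> \<P>(\<omega> in distr M N f. in_box I a b (\<lambda>k. Z k \<omega>) \<and> s \<le> (\<Sum>k\<in>I. Z k \<omega>) \<and> Z i \<omega> \<in> B) *
       \<P>(\<omega> in distr M N f. in_box I a b (\<lambda>k. Z k \<omega>))) \<longleftrightarrow>
       (\<P>(\<omega> in M. in_box I a b (\<lambda>k. Z k (f \<omega>)) \<and> s \<le> (\<Sum>k\<in>I. Z k (f \<omega>))) *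
       \<P>(\<omega> in M. in_box I a b (\<lambda>k. Z k (f \<omega>)) \<and> Z i (f \<omega>) \<in> B)
       \<le> \<P>(\<omega> in M. in_box I a b (\<lambda>k. Z k (f \<omega>)) \<and> s \<le> (\<Sum>k\<in>I. Z k (f \<omega>)) \<and> Z i (f \<omega>) \<in> B) *
       \<P>(\<omega> in M. in_box I a b (\<lambda>k. Z k (f \<omega>))))"
      by (intro arg_cong2[where f="(\<le>)"] arg_cong2[where f="(*)"] prob) measurable
  qed
qed

lemma box_assoc_cong_AE:
  assumes I: "finite I" "i \<in> I"
    and [measurable]: "\<And>k. k \<in> I \<Longrightarrow> Z k \<in> borel_measurable M" "\<And>k. k \<in> I \<Longrightarrow> Z' k \<in> borel_measurable M"
    and eq: "\<And>k. k \<in> I \<Longrightarrow> AE \<omega> in M. Z k \<omega> = Z' k \<omega>"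
  shows "box_assoc M I Z i \<longleftrightarrow> box_assoc M I Z' i"
proof -
  note [measurable] = I
  have "AE \<omega> in M. \<forall>k\<in>I. Z k \<omega> = Z' k \<omega>"
    using eq I by (simp add: AE_finite_all)
  then have AE: "AE \<omega> in M. in_box I a b (\<lambda>k. Z k \<omega>) = in_box I a b (\<lambda>k. Z' k \<omega>) \<and>
      (\<Sum>k\<in>I. Z k \<omega>) = (\<Sum>k\<in>I. Z' k \<omega>) \<and> Z i \<omega> = Z' i \<omega>" for a b
    by eventually_elim (use I in \<open>auto simp: in_box_def\<close>)
  \<comment> \<open>\<open>P\<close> stands for any of the four events in \<open>box_assoc\<close>,
    so that one almost sure argument serves all of them.\<close>
  have prob: "\<P>(\<omega> in M. P (in_box I a b (\<lambda>k. Z k \<omega>)) (\<Sum>k\<in>I. Z k \<omega>) (Z i \<omega>)) =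
      \<P>(\<omega> in M. P (in_box I a b (\<lambda>k. Z' k \<omega>)) (\<Sum>k\<in>I. Z' k \<omega>) (Z' i \<omega>))"
    if "Measurable.pred M (\<lambda>\<omega>. P (in_box I a b (\<lambda>k. Z k \<omega>)) (\<Sum>k\<in>I. Z k \<omega>) (Z i \<omega>))"
      "Measurable.pred M (\<lambda>\<omega>. P (in_box I a b (\<lambda>k. Z' k \<omega>)) (\<Sum>k\<in>I. Z' k \<omega>) (Z' i \<omega>))" for a b P
    using AE[of a b] that by (intro measure_eq_AE) auto
  show ?thesis
    unfolding box_assoc_def
  proof (intro all_cong1 imp_cong refl)
    fix a b s and B :: "real set"
    assume [measurable]: "B \<in> sets borel"
    show "(\<P>(\<omega> in M. in_box I a b (\<lambda>k. Z k \<omega>) \<and> s \<le> (\<Sum>k\<in>I. Z k \<omega>)) *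
       \<P>(\<omega> in M. in_box I a b (\<lambda>k. Z k \<omega>) \<and> Z i \<omega> \<in> B)
       \<le> \<P>(\<omega> in M. in_box I a b (\<lambda>k. Z k \<omega>) \<and> s \<le> (\<Sum>k\<in>I. Z k \<omega>) \<and> Z i \<omega> \<in> B) *
       \<P>(\<omega> in M. in_box I a b (\<lambda>k. Z k \<omega>))) \<longleftrightarrow>
       (\<P>(\<omega> in M. in_box I a b (\<lambda>k. Z' k \<omega>) \<and> s \<le> (\<Sum>k\<in>I. Z' k \<omega>)) *
       \<P>(\<omega> in M. in_box I a b (\<lambda>k. Z' k \<omega>) \<and> Z' i \<omega> \<in> B)
       \<le> \<P>(\<omega> in M. in_box I a b (\<lambda>k. Z' k \<omega>) \<and> s \<le> (\<Sum>k\<in>I. Z' k \<omega>) \<and> Z' i \<omega> \<in> B) *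
       \<P>(\<omega> in M. in_box I a b (\<lambda>k. Z' k \<omega>)))"
      by (intro arg_cong2[where f="(\<le>)"] arg_cong2[where f="(*)"]
          prob[where P="\<lambda>x y z. x \<and> s \<le> y"] prob[where P="\<lambda>x y z. x \<and> z \<in> B"]
          prob[where P="\<lambda>x y z. x \<and> s \<le> y \<and> z \<in> B"] prob[where P="\<lambda>x y z. x"]) measurable
  qed
qed

text \<open>The event \<open>Z i \<in> B\<close> is everything or nothing, and in either case the
  two sides agree.\<close>

lemma box_assoc_const:
  assumes "\<And>\<omega>. \<omega> \<in> space M \<Longrightarrow> Z i \<omega> = c"
  shows "box_assoc M I Z i"
  unfolding box_assoc_def
proof (intro allI impI)
  fix a b s B
  show "\<P>(\<omega> in M. in_box I a b (\<lambda>k. Z k \<omega>) \<and> s \<le> (\<Sum>k\<in>I. Z k \<omega>)) *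
      \<P>(\<omega> in M. in_box I a b (\<lambda>k. Z k \<omega>) \<and> Z i \<omega> \<in> B)
    \<le> \<P>(\<omega> in M. in_box I a b (\<lambda>k. Z k \<omega>) \<and> s \<le> (\<Sum>k\<in>I. Z k \<omega>) \<and> Z i \<omega> \<in> B) *
      \<P>(\<omega> in M. in_box I a b (\<lambda>k. Z k \<omega>))"
    by (cases "c \<in> B") (simp_all add: assms cong: conj_cong)
qed

text \<open>White noise is invariant under the rotation with \<open>- s\<close>; moving that
  rotation to the coefficients turns the sign back to \<open>s\<close>.\<close>

lemma box_assoc_rotate_coords:
  assumes "finite I" "i \<in> I" and J: "finite J" "j \<in> J" "k \<in> J" "j \<noteq> k"
    and cs: "c\<^sup>2 + s\<^sup>2 = 1" "c \<noteq> 0"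
  shows "box_assoc (std_gauss J) I (\<lambda>l. dot J (rotate_coords j k c s (v l))) i \<longleftrightarrow>
    box_assoc (std_gauss J) I (\<lambda>l. dot J (v l)) i"
proof -
  have cs': "c\<^sup>2 + (- s)\<^sup>2 = 1" using cs by simp
  show ?thesis
    using box_assoc_distr[OF measurable_rotate_coords[OF J(2,3)] \<open>finite I\<close> _ \<open>i \<in> I\<close>,
        of "\<lambda>l. dot J (v l)" c "- s"]
    by (simp add: distr_std_gauss_rotate[OF J cs' cs(2)] dot_rotate_coords[OF J])
qed

text \<open>A vector is moved onto a coordinate axis by rotations in coordinate planes, each of which
  annihilates one more coordinate.\<close>

lemma exists_aligned:
  assumes "finite I" "i \<in> I" "finite J"
  shows "\<exists>v'. (\<forall>k l. dot J (v' k) (v' l) = dot J (v k) (v l)) \<and> card {j\<in>J. v' i j \<noteq> 0} \<le> 1 \<and>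
    (box_assoc (std_gauss J) I (\<lambda>l. dot J (v' l)) i \<longrightarrow> box_assoc (std_gauss J) I (\<lambda>l. dot J (v l)) i)"
proof (induction "card {j\<in>J. v i j \<noteq> 0}" arbitrary: v rule: less_induct)
  case less
  let ?S = "{j\<in>J. v i j \<noteq> 0}"
  have "finite ?S" using \<open>finite J\<close> by simp
  show ?case
  proof (cases "card ?S \<le> 1")
    case True
    then show ?thesis by (intro exI[of _ v]) auto
  next
    case False
    then obtain j k where jk: "j \<in> ?S" "k \<in> ?S" "j \<noteq> k"
      using card_le_Suc0_iff_eq[OF \<open>finite ?S\<close>] by auto
    then have J: "j \<in> J" "k \<in> J" by auto
    \<comment> \<open>\<open>c\<close> and \<open>s\<close> are the cosine and sine of the angle of
      the point with coordinates \<open>v i j\<close> and \<open>v i k\<close>, so the rotation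
      replaces these entries by \<open>r\<close> and 0.\<close>
    define r where "r = sqrt ((v i j)\<^sup>2 + (v i k)\<^sup>2)"
    have r: "r\<^sup>2 = (v i j)\<^sup>2 + (v i k)\<^sup>2" "r \<noteq> 0"
      using jk by (auto simp: r_def add_nonneg_eq_0_iff)
    define c where "c = v i j / r"
    define s where "s = v i k / r"
    have cs: "c\<^sup>2 + s\<^sup>2 = 1" "c \<noteq> 0"
      using jk r by (auto simp: c_def s_def power_divide simp flip: add_divide_distrib)
    define v' where "v' l = rotate_coords j k c s (v l)" for l
    have dot: "dot J (v' l) (v' l') = dot J (v l) (v l')" for l l'
      unfolding v'_def by (rule dot_rotate_coords_both) (use assms J jk cs in auto)
    have assoc: "box_assoc (std_gauss J) I (\<lambda>l. dot J (v' l)) i \<longleftrightarrow> box_assoc (std_gauss J) I (\<lambda>l. dot J (v l)) i"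
      unfolding v'_def by (rule box_assoc_rotate_coords) (use assms J jk cs in auto)
    have "v' i k = 0"
      using jk by (simp add: v'_def rotate_coords_def c_def s_def)
    \<comment> \<open>No new nonzero entry arises: only the entries at \<open>j\<close> and
      \<open>k\<close> change, and both were nonzero.\<close>
    moreover have "v i l \<noteq> 0" if "v' i l \<noteq> 0" for l
      using that jk by (auto simp: v'_def rotate_coords_def split: if_splits)
    ultimately have "{l\<in>J. v' i l \<noteq> 0} \<subset> ?S"
      using jk by (intro psubsetI subsetI) auto
    then have "card {l\<in>J. v' i l \<noteq> 0} < card ?S"
      using \<open>finite ?S\<close> by (rule psubset_card_mono[rotated])
    from less[of v', OF this] obtain v'' where "\<forall>k l. dot J (v'' k) (v'' l) = dot J (v' k) (v' l)"
      "card {j\<in>J. v'' i j \<noteq> 0} \<le> 1"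
      "box_assoc (std_gauss J) I (\<lambda>l. dot J (v'' l)) i \<longrightarrow> box_assoc (std_gauss J) I (\<lambda>l. dot J (v' l)) i"
      by blast
    then show ?thesis using dot assoc by (intro exI[of _ v'']) simp
  qed
qed

section \<open>Induction on the number of variables\<close>

text \<open>Since \<open>v i\<close> vanishes on \<open>J\<close>, the noise coordinate
  \<open>j\<close> alone drives variable \<open>i\<close>. The quotient \<open>v k j / v i j\<close>
  is the regression coefficient of variable \<open>k\<close> on it, and the part over
  \<open>J\<close> is the independent residual, which is the situation of
  \<open>box_assoc_pair\<close>.\<close>

lemma box_assoc_aligned:
  fixes v :: "'i \<Rightarrow> 'j \<Rightarrow> real"
  assumes "finite I" "i \<notin> I" "finite J" "j \<notin> J" and r: "v i j \<noteq> 0" and vi: "\<And>l. l \<in> J \<Longrightarrow> v i l = 0"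
    and assoc: "\<And>k. k \<in> I \<Longrightarrow> box_assoc (std_gauss J) I (\<lambda>l. dot J (v l)) k"
    and p: "\<And>k. k \<in> I \<Longrightarrow> v k j / v i j \<le> 0" "- 1 \<le> (\<Sum>k\<in>I. v k j / v i j)"
  shows "box_assoc (std_gauss (insert j J)) (insert i I) (\<lambda>l. dot (insert j J) (v l)) i"
proof -
  define p where "p k = - (v k j / v i j)" for k
  define f :: "real \<times> ('j \<Rightarrow> real) \<Rightarrow> 'j \<Rightarrow> real" where "f = (\<lambda>(x, y). y(j := x))"
  have distr: "distr (std_normal \<Otimes>\<^sub>M std_gauss J) (std_gauss (insert j J)) f = std_gauss (insert j J)"
    unfolding std_gauss_def f_def
    by (rule distr_pair_PiM_eq_PiM) (simp_all add: prob_space_std_normal)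
  have [measurable]: "f \<in> measurable (std_normal \<Otimes>\<^sub>M std_gauss J) (std_gauss (insert j J))"
    unfolding std_gauss_def f_def by measurable
  have "box_assoc (std_normal \<Otimes>\<^sub>M std_gauss J) (insert i I)
      (\<lambda>k (x, y). if k = i then v i j * x else dot J (v k) y - p k * (v i j * x)) i"
    by (rule box_assoc_pair)
      (use assms in \<open>auto simp: p_def sum_negf intro: prob_space_std_normal prob_space_std_gauss\<close>)
  also have "(\<lambda>k (x, y). if k = i then v i j * x else dot J (v k) y - p k * (v i j * x)) =
      (\<lambda>k \<omega>. dot (insert j J) (v k) (f \<omega>))"
  proof (intro ext)
    fix k and \<omega> :: "real \<times> ('j \<Rightarrow> real)"
    obtain x y where \<omega>: "\<omega> = (x, y)" by (cases \<omega>)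
    have "(\<Sum>l\<in>J. v k l * (y(j := x)) l) = (\<Sum>l\<in>J. v k l * y l)"
      using \<open>j \<notin> J\<close> by (intro sum.cong) auto
    then have "dot (insert j J) (v k) (f \<omega>) = v k j * x + dot J (v k) y"
      using \<open>finite J\<close> \<open>j \<notin> J\<close> by (simp add: dot_def f_def \<omega>)
    moreover have "dot J (v i) y = 0" by (simp add: dot_def vi)
    ultimately show "(case \<omega> of (x, y) \<Rightarrow> if k = i then v i j * x else dot J (v k) y - p k * (v i j * x)) =
        dot (insert j J) (v k) (f \<omega>)"
      using r by (simp add: \<omega> p_def)
  qed
  finally have "box_assoc (distr (std_normal \<Otimes>\<^sub>M std_gauss J) (std_gauss (insert j J)) f)
      (insert i I) (\<lambda>l. dot (insert j J) (v l)) i"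
    using \<open>finite I\<close> by (subst box_assoc_distr) auto
  then show ?thesis by (simp only: distr)
qed

text \<open>The hypotheses involve only the Gram matrix, which alignment preserves, and they pass to
  the residuals, whose Gram matrix is a Schur complement. \<open>v\<close> and \<open>J\<close> are
  generalized because alignment changes the former and splitting off a coordinate shrinks the
  latter.\<close>

lemma box_assoc_std_gauss:
  fixes v :: "'i \<Rightarrow> 'j \<Rightarrow> real"
  assumes "finite I" "i \<in> I" "finite J"
    and "\<And>k l. k \<in> I \<Longrightarrow> l \<in> I \<Longrightarrow> k \<noteq> l \<Longrightarrow> dot J (v k) (v l) \<le> 0"
    and "\<And>k. k \<in> I \<Longrightarrow> 0 \<le> (\<Sum>l\<in>I. dot J (v k) (v l))"
  shows "box_assoc (std_gauss J) I (\<lambda>l. dot J (v l)) i"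
  using assms
proof (induction I arbitrary: i J v rule: finite_psubset_induct)
  case (psubset I i J w)
  obtain v where dot_v: "\<And>k l. dot J (v k) (v l) = dot J (w k) (w l)" "card {j\<in>J. v i j \<noteq> 0} \<le> 1"
    and reduce: "box_assoc (std_gauss J) I (\<lambda>l. dot J (v l)) i \<Longrightarrow> box_assoc (std_gauss J) I (\<lambda>l. dot J (w l)) i"
    using exists_aligned[OF psubset.hyps psubset.prems(1,2), of w] by blast
  have off_diag: "dot J (v k) (v l) \<le> 0" if "k \<in> I" "l \<in> I" "k \<noteq> l" for k l
    using psubset.prems that by (simp add: dot_v)
  have row: "0 \<le> (\<Sum>l\<in>I. dot J (v k) (v l))" if "k \<in> I" for k
    using psubset.prems that by (simp add: dot_v)
  show ?case
  proof (rule reduce, cases "\<forall>j\<in>J. v i j = 0")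
    \<comment> \<open>Variable \<open>i\<close> is identically zero here; otherwise
      \<open>v i\<close> has exactly one nonzero entry in \<open>J\<close>, by which one can
      divide.\<close>
    case True
    then have "dot J (v i) x = 0" for x by (simp add: dot_def)
    then show "box_assoc (std_gauss J) I (\<lambda>l. dot J (v l)) i"
      by (intro box_assoc_const) auto
  next
    case False
    then obtain j where j: "j \<in> J" "v i j \<noteq> 0" by auto
    define r where "r = v i j"
    define J' where "J' = J - {j}"
    define I' where "I' = I - {i}"
    have I: "I = insert i I'" "i \<notin> I'" "finite I'" "I' \<subset> I"
      using psubset.hyps psubset.prems(1) by (auto simp: I'_def)
    have J: "J = insert j J'" "j \<notin> J'" "finite J'"
      using psubset.prems(2) j by (auto simp: J'_def)
    have vi: "v i l = 0" if "l \<in> J'" for l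
      using dot_v(2) card_le_Suc0_iff_eq[of "{j\<in>J. v i j \<noteq> 0}"] psubset.prems(2) j that
      by (auto simp: J'_def)
    \<comment> \<open>The sign makes \<open>p\<close> nonnegative on \<open>I'\<close>, while
      \<open>p i = - 1\<close>, so that \<open>dot_J\<close> also covers the index
      \<open>i\<close>.\<close>
    define p where "p k = - (v k j / r)" for k
    have vp: "v k j = - p k * r" for k
      using j by (simp add: p_def r_def)
    have dot_J: "dot J (v k) (v l) = p k * p l * r\<^sup>2 + dot J' (v k) (v l)" for k l
      using J by (simp add: dot_def vp power2_eq_square)
    have dot_i: "dot J (v k) (v i) = - p k * r\<^sup>2" for k
      using vi by (simp add: dot_J) (simp add: dot_def p_def r_def j)
    have r2: "0 < r\<^sup>2" using j by (simp add: r_def)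
    have p_nonneg: "0 \<le> p k" if "k \<in> I'" for k
      using off_diag[of k i] that I r2 by (auto simp: dot_i zero_le_mult_iff)
    have row_I': "(\<Sum>l\<in>I. dot J (v k) (v l)) = - p k * r\<^sup>2 + (\<Sum>l\<in>I'. dot J (v k) (v l))" for k
      using I by (simp add: dot_i)
    \<comment> \<open>Row \<open>i\<close> of the Gram matrix sums to
      \<open>(1 - (\<Sum>k\<in>I'. p k)) * r\<^sup>2\<close>, so condition (B) for \<open>i\<close>
      is this bound.\<close>
    have p_sum: "(\<Sum>k\<in>I'. p k) \<le> 1"
    proof -
      have "dot J (v i) (v l) = - p l * r\<^sup>2" for l
        using dot_i[of l] by (simp add: dot_def mult.commute)
      moreover have "p i = - 1" using j by (simp add: p_def r_def)
      ultimately have "(\<Sum>l\<in>I. dot J (v i) (v l)) = (1 - (\<Sum>k\<in>I'. p k)) * r\<^sup>2"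
        unfolding row_I' by (simp add: sum_negf sum_distrib_right left_diff_distrib)
      then show ?thesis
        using row[of i] psubset.prems(1) r2 by (simp add: zero_le_mult_iff)
    qed
    have "box_assoc (std_gauss J') I' (\<lambda>l. dot J' (v l)) k" if k: "k \<in> I'" for k
    proof (rule psubset.IH)
      show "dot J' (v k) (v l) \<le> 0" if "k \<in> I'" "l \<in> I'" "k \<noteq> l" for k l
      proof -
        have "dot J (v k) (v l) \<le> 0" using off_diag that I by auto
        moreover have "0 \<le> p k * p l * r\<^sup>2" using p_nonneg that by auto
        ultimately show ?thesis by (simp add: dot_J)
      qed
      \<comment> \<open>The residual row sum is the old one plus
        \<open>p k * r\<^sup>2 * (1 - (\<Sum>l\<in>I'. p l))\<close>, a nonnegative amount.\<close>
      show "0 \<le> (\<Sum>l\<in>I'. dot J' (v k) (v l))" if k: "k \<in> I'" for k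
      proof -
        have "0 \<le> - p k * r\<^sup>2 + (\<Sum>l\<in>I'. p k * p l * r\<^sup>2 + dot J' (v k) (v l))"
          using row[of k] k I unfolding row_I' by (simp add: dot_J)
        also have "\<dots> = (\<Sum>l\<in>I'. dot J' (v k) (v l)) - p k * r\<^sup>2 * (1 - (\<Sum>l\<in>I'. p l))"
          by (simp add: sum.distrib sum_distrib_left sum_distrib_right algebra_simps)
        also have "\<dots> \<le> (\<Sum>l\<in>I'. dot J' (v k) (v l))"
          using p_nonneg[OF k] p_sum by simp
        finally show ?thesis .
      qed
    qed (use I J k in auto)
    then show "box_assoc (std_gauss J) I (\<lambda>l. dot J (v l)) i"
      unfolding I(1) J(1)
      by (intro box_assoc_aligned)
        (use I J j vi p_nonneg p_sum in \<open>auto simp: p_def r_def sum_negf\<close>)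
  qed
qed

section \<open>Jointly normal variables\<close>

context prob_space
begin

lemma distr_indep_std_normal:
  assumes "J \<noteq> {}" and indep: "indep_vars (\<lambda>_. borel) X J"
    and X: "\<And>j. j \<in> J \<Longrightarrow> distributed M lborel (X j) std_normal_density"
  shows "distr M (std_gauss J) (\<lambda>\<omega>. \<lambda>j\<in>J. X j \<omega>) = std_gauss J"
proof -
  have rv: "X j \<in> borel_measurable M" if "j \<in> J" for j
    using distributed_measurable[OF X[OF that]] by simp
  have law: "distr M borel (X j) = std_normal" if "j \<in> J" for j
    using distributed_distr_eq_density[OF X[OF that]] unfolding std_normal_def
    by (metis distr_cong sets_lborel)
  have "distr M (std_gauss J) (\<lambda>\<omega>. \<lambda>j\<in>J. X j \<omega>) = distr M (\<Pi>\<^sub>M j\<in>J. borel) (\<lambda>\<omega>. \<lambda>j\<in>J. X j \<omega>)"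
    by (intro distr_cong sets_std_gauss) auto
  also have "\<dots> = (\<Pi>\<^sub>M j\<in>J. distr M borel (X j))"
    using indep_vars_iff_distr_eq_PiM'[OF \<open>J \<noteq> {}\<close>, where X=X and M'="\<lambda>_. borel"] rv indep by blast
  also have "\<dots> = std_gauss J"
    unfolding std_gauss_def by (intro PiM_cong refl law)
  finally show ?thesis .
qed

lemma std_normal_moments:
  assumes X: "distributed M lborel X std_normal_density"
  shows "integrable M X" "expectation X = 0"
    "integrable M (\<lambda>\<omega>. X \<omega> * X \<omega>)" "expectation (\<lambda>\<omega>. X \<omega> * X \<omega>) = 1"
proof -
  have "integrable M (\<lambda>\<omega>. X \<omega> ^ k)" for k
    using distributed_integrable[OF X, of "\<lambda>x. x ^ k"] integrable_std_normal_moment by simp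
  from this[of 1] this[of 2] show "integrable M X" "integrable M (\<lambda>\<omega>. X \<omega> * X \<omega>)"
    by (simp_all add: power2_eq_square)
  show "expectation X = 0"
    by (rule standard_normal_distributed_expectation[OF X])
  then show "expectation (\<lambda>\<omega>. X \<omega> * X \<omega>) = 1"
    using standard_normal_distributed_variance[OF X] by (simp add: power2_eq_square)
qed

lemma indep_std_normal_product:
  assumes indep: "indep_vars (\<lambda>_. borel) X J"
    and X: "\<And>j. j \<in> J \<Longrightarrow> distributed M lborel (X j) std_normal_density"
    and jk: "j \<in> J" "k \<in> J"
  shows "integrable M (\<lambda>\<omega>. X j \<omega> * X k \<omega>)"
    "expectation (\<lambda>\<omega>. X j \<omega> * X k \<omega>) = (if j = k then 1 else 0)"
proof -
  have "integrable M (\<lambda>\<omega>. X j \<omega> * X k \<omega>) \<and> expectation (\<lambda>\<omega>. X j \<omega> * X k \<omega>) = 0" if "j \<noteq> k"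
  proof -
    have "indep_vars (\<lambda>_. borel) X {j, k}"
      using indep by (rule indep_vars_subset) (use jk in auto)
    moreover have "integrable M (X l)" if "l \<in> {j, k}" for l
      using std_normal_moments(1)[OF X] jk that by auto
    ultimately show ?thesis
      using indep_vars_lebesgue_integral[of "{j, k}" X] indep_vars_integrable[of "{j, k}" X]
        std_normal_moments(2)[OF X] jk that by simp
  qed
  then show "integrable M (\<lambda>\<omega>. X j \<omega> * X k \<omega>)"
    "expectation (\<lambda>\<omega>. X j \<omega> * X k \<omega>) = (if j = k then 1 else 0)"
    using std_normal_moments[OF X] jk by (cases "j = k"; simp)+
qed

text \<open>The \<open>X j\<close> are centred and orthonormal among square-integrable variables, so
  conditions on covariances become conditions on dot products of coefficient vectors.\<close>

lemma expectation_dot_std_normal: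
  assumes "finite J" and indep: "indep_vars (\<lambda>_. borel) X J"
    and X: "\<And>j. j \<in> J \<Longrightarrow> distributed M lborel (X j) std_normal_density"
  shows "expectation (\<lambda>\<omega>. dot J u (\<lambda>j. X j \<omega>)) = 0"
    and "expectation (\<lambda>\<omega>. dot J u (\<lambda>j. X j \<omega>) * dot J w (\<lambda>j. X j \<omega>)) = dot J u w"
    and "integrable M (\<lambda>\<omega>. dot J u (\<lambda>j. X j \<omega>))"
    and "integrable M (\<lambda>\<omega>. dot J u (\<lambda>j. X j \<omega>) * dot J w (\<lambda>j. X j \<omega>))"
proof -
  note mom = std_normal_moments[OF X] and prod = indep_std_normal_product[OF indep X]
  show "expectation (\<lambda>\<omega>. dot J u (\<lambda>j. X j \<omega>)) = 0" "integrable M (\<lambda>\<omega>. dot J u (\<lambda>j. X j \<omega>))"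
    unfolding dot_def by (simp_all add: mom)
  have eq: "(\<lambda>\<omega>. dot J u (\<lambda>j. X j \<omega>) * dot J w (\<lambda>j. X j \<omega>)) =
      (\<lambda>\<omega>. \<Sum>j\<in>J. \<Sum>k\<in>J. u j * w k * (X j \<omega> * X k \<omega>))"
    by (simp add: dot_def sum_product mult_ac)
  show "integrable M (\<lambda>\<omega>. dot J u (\<lambda>j. X j \<omega>) * dot J w (\<lambda>j. X j \<omega>))"
    unfolding eq by (intro Bochner_Integration.integrable_sum integrable_mult_right prod)
  have "expectation (\<lambda>\<omega>. dot J u (\<lambda>j. X j \<omega>) * dot J w (\<lambda>j. X j \<omega>)) =
      (\<Sum>j\<in>J. \<Sum>k\<in>J. u j * w k * expectation (\<lambda>\<omega>. X j \<omega> * X k \<omega>))"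
    unfolding eq by (simp add: prod)
  also have "\<dots> = (\<Sum>j\<in>J. \<Sum>k\<in>J. if j = k then u j * w k else 0)"
    by (intro sum.cong refl) (simp add: prod)
  also have "\<dots> = dot J u w"
    using \<open>finite J\<close> by (simp add: dot_def sum.delta)
  finally show "expectation (\<lambda>\<omega>. dot J u (\<lambda>j. X j \<omega>) * dot J w (\<lambda>j. X j \<omega>)) = dot J u w" .
qed

lemma box_assoc_indep_std_normal:
  assumes IJ: "finite I" "i \<in> I" "finite J" and indep: "indep_vars (\<lambda>_. borel) X J"
    and X: "\<And>j. j \<in> J \<Longrightarrow> distributed M lborel (X j) std_normal_density"
    and "\<And>k l. k \<in> I \<Longrightarrow> l \<in> I \<Longrightarrow> k \<noteq> l \<Longrightarrow> dot J (v k) (v l) \<le> 0"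
    and "\<And>k. k \<in> I \<Longrightarrow> 0 \<le> (\<Sum>l\<in>I. dot J (v k) (v l))"
  shows "box_assoc M I (\<lambda>k \<omega>. dot J (v k) (\<lambda>j. X j \<omega>)) i"
\<comment> \<open>For empty \<open>J\<close> every combination is the constant 0;
  \<open>distr_indep_std_normal\<close> treats nonempty \<open>J\<close>.\<close>
proof (cases "J = {}")
  case True
  then show ?thesis by (intro box_assoc_const) (simp add: dot_def)
next
  case False
  \<comment> \<open>Restriction to \<open>J\<close> yields points of the product space, which are
    extensional functions.\<close>
  let ?X = "\<lambda>\<omega>. \<lambda>j\<in>J. X j \<omega>"
  have "X j \<in> borel_measurable M" if "j \<in> J" for j
    using distributed_measurable[OF X[OF that]] by simp
  then have "?X \<in> measurable M (\<Pi>\<^sub>M j\<in>J. borel)" by measurable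
  then have "?X \<in> measurable M (std_gauss J)"
    by (simp cong: measurable_cong_sets add: sets_std_gauss)
  moreover have law: "distr M (std_gauss J) ?X = std_gauss J"
    by (rule distr_indep_std_normal[OF False indep X])
  have "box_assoc (distr M (std_gauss J) ?X) I (\<lambda>k. dot J (v k)) i"
    unfolding law by (rule box_assoc_std_gauss[OF IJ]) (use assms in auto)
  ultimately have "box_assoc M I (\<lambda>k \<omega>. dot J (v k) (?X \<omega>)) i"
    using IJ by (subst (asm) box_assoc_distr) auto
  then show ?thesis by (simp add: dot_def)
qed

text \<open>Constant \<open>Y j\<close> only contribute to the means, which vanish.\<close>

lemma jointly_normal_standardized:
  assumes "jointly_normal M m Z" and mean: "\<forall>i\<in>{1..m}. expectation (Z i) = 0"
  obtains J :: "nat set" and X :: "nat \<Rightarrow> 'a \<Rightarrow> real" and v :: "nat \<Rightarrow> nat \<Rightarrow> real"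
  where "finite J" "indep_vars (\<lambda>_. borel) X J"
    "\<And>j. j \<in> J \<Longrightarrow> distributed M lborel (X j) std_normal_density"
    "\<And>i. i \<in> {1..m} \<Longrightarrow> AE \<omega> in M. Z i \<omega> = dot J (v i) (\<lambda>j. X j \<omega>)"
proof -
  have Z_meas: "Z i \<in> borel_measurable M" if "i \<in> {1..m}" for i
    using assms(1) that by (simp add: jointly_normal_def)
  obtain n and Y :: "nat \<Rightarrow> 'a \<Rightarrow> real" and c :: "nat \<Rightarrow> nat \<Rightarrow> real"
    where normal: "\<forall>j\<in>{1..n}. normal_rv M (Y j)"
      and indep: "indep_vars (\<lambda>_. borel) Y {1..n}"
      and Z: "\<forall>i\<in>{1..m}. AE \<omega> in M. Z i \<omega> = (\<Sum>j=1..n. c i j * Y j \<omega>)"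
    using assms(1) unfolding jointly_normal_def by blast
  define J where "J = {j\<in>{1..n}. \<exists>\<mu> \<sigma>. \<sigma> > 0 \<and> distributed M lborel (Y j) (normal_density \<mu> \<sigma>)}"
  have J: "finite J" "J \<subseteq> {1..n}" by (auto simp: J_def)
  have "\<exists>\<mu> \<sigma>. \<sigma> > 0 \<and> distributed M lborel (Y j) (normal_density \<mu> \<sigma>)" if "j \<in> J" for j
    using that by (simp add: J_def)
  then obtain \<mu> \<sigma> where \<sigma>: "\<And>j. j \<in> J \<Longrightarrow> \<sigma> j > 0"
    and Y: "\<And>j. j \<in> J \<Longrightarrow> distributed M lborel (Y j) (normal_density (\<mu> j) (\<sigma> j))"
    by metis
  have "\<exists>d. AE \<omega> in M. Y j \<omega> = d" if "j \<in> {1..n} - J" for j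
    using bspec[OF normal, of j] that by (auto simp: normal_rv_def J_def)
  then obtain d where d: "\<And>j. j \<in> {1..n} - J \<Longrightarrow> AE \<omega> in M. Y j \<omega> = d j"
    by metis
  define X where "X j \<omega> = (Y j \<omega> - \<mu> j) / \<sigma> j" for j \<omega>
  have X: "distributed M lborel (X j) std_normal_density" if "j \<in> J" for j
    unfolding X_def using normal_standard_normal_convert[OF \<sigma>[OF that]] Y[OF that] by blast
  have indep_X: "indep_vars (\<lambda>_. borel) X J"
    unfolding X_def by (rule indep_vars_compose2[OF indep_vars_subset[OF indep J(2)]]) measurable
  define v where "v i j = c i j * \<sigma> j" for i j
  \<comment> \<open>\<open>v\<close> has absorbed the standard deviations; \<open>e i\<close>
    collects the means of the nondegenerate \<open>Y j\<close> and the values of the constant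
    ones.\<close>
  define e where "e i = (\<Sum>j\<in>J. c i j * \<mu> j) + (\<Sum>j\<in>{1..n} - J. c i j * d j)" for i
  have Z_e: "AE \<omega> in M. Z i \<omega> = dot J (v i) (\<lambda>j. X j \<omega>) + e i" if "i \<in> {1..m}" for i
  proof -
    have "AE \<omega> in M. \<forall>j\<in>{1..n} - J. Y j \<omega> = d j"
      using d by (simp add: AE_finite_all)
    then show ?thesis
      using bspec[OF Z that]
    proof eventually_elim
      case (elim \<omega>)
      have "(\<Sum>j=1..n. c i j * Y j \<omega>) = (\<Sum>j\<in>J. c i j * Y j \<omega>) + (\<Sum>j\<in>{1..n} - J. c i j * Y j \<omega>)"
        using J by (subst sum.subset_diff[of J]) auto
      also have "(\<Sum>j\<in>J. c i j * Y j \<omega>) = (\<Sum>j\<in>J. v i j * X j \<omega> + c i j * \<mu> j)"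
        using \<sigma> by (intro sum.cong refl) (fastforce simp: v_def X_def field_simps)
      finally show ?case
        using elim by (simp add: dot_def e_def sum.distrib)
    qed
  qed
  \<comment> \<open>The linear part is centred, so \<open>e i\<close> is the mean of
    \<open>Z i\<close>.\<close>
  have "e i = 0" if "i \<in> {1..m}" for i
  proof -
    note ex = expectation_dot_std_normal[OF J(1) indep_X X]
    have "expectation (Z i) = expectation (\<lambda>\<omega>. dot J (v i) (\<lambda>j. X j \<omega>) + e i)"
      using Z_e[OF that] Z_meas[OF that] ex(3)[of "v i"] by (intro integral_cong_AE) auto
    also have "\<dots> = e i" by (simp add: ex prob_space)
    finally show ?thesis using mean that by simp
  qed
  with Z_e have "\<And>i. i \<in> {1..m} \<Longrightarrow> AE \<omega> in M. Z i \<omega> = dot J (v i) (\<lambda>j. X j \<omega>)" by simp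
  from that[OF J(1) indep_X X this] show thesis .
qed

end

section \<open>Passage from covariances to conditional probabilities\<close>

theorem theorem1p4:
  fixes M :: "'a measure" and m :: nat and Z :: "nat \<Rightarrow> 'a \<Rightarrow> real"
  assumes "prob_space M"
    and "jointly_normal M m Z"
    and A_mean: "\<forall>i\<in>{1..m}. prob_space.expectation M (Z i) = 0"
    and A_cov: "\<forall>i\<in>{1..m}. \<forall>j\<in>{1..m}. i \<noteq> j \<longrightarrow>
          prob_space.expectation M (\<lambda>\<omega>. Z i \<omega> * Z j \<omega>) \<le> 0"
    and B: "\<forall>i\<in>{1..m}. prob_space.expectation M (\<lambda>\<omega>. Z i \<omega> * (\<Sum>j=1..m. Z j \<omega>)) \<ge> 0"
  shows "\<forall>i\<in>{1..m}. positively_associated_given M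
           (\<lambda>\<omega>. (\<Sum>j=1..m. Z j \<omega>) / real m) (Z i) (box_events M m Z)"
proof
  interpret prob_space M by fact
  fix i assume i: "i \<in> {1..m}"
  have Z_meas [measurable]: "Z k \<in> borel_measurable M" if "k \<in> {1..m}" for k
    using assms(2) that by (simp add: jointly_normal_def)
  obtain J :: "nat set" and X :: "nat \<Rightarrow> 'a \<Rightarrow> real" and v :: "nat \<Rightarrow> nat \<Rightarrow> real"
    where J: "finite J" and indep: "indep_vars (\<lambda>_. borel) X J"
      and X: "\<And>j. j \<in> J \<Longrightarrow> distributed M lborel (X j) std_normal_density"
      and Z: "\<And>i. i \<in> {1..m} \<Longrightarrow> AE \<omega> in M. Z i \<omega> = dot J (v i) (\<lambda>j. X j \<omega>)"
    using jointly_normal_standardized[OF assms(2) A_mean] by blast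
  note ex = expectation_dot_std_normal[OF J indep X]
  let ?W = "\<lambda>k \<omega>. dot J (v k) (\<lambda>j. X j \<omega>)"
  have [measurable]: "?W k \<in> borel_measurable M" for k
    using ex(3) by blast
  have int: "integrable M (\<lambda>\<omega>. Z k \<omega> * Z l \<omega>)" and cov: "expectation (\<lambda>\<omega>. Z k \<omega> * Z l \<omega>) = dot J (v k) (v l)"
    if kl: "k \<in> {1..m}" "l \<in> {1..m}" for k l
  proof -
    note [measurable] = Z_meas[OF kl(1)] Z_meas[OF kl(2)]
    have eq: "AE \<omega> in M. Z k \<omega> * Z l \<omega> = ?W k \<omega> * ?W l \<omega>"
      using Z[OF kl(1)] Z[OF kl(2)] by eventually_elim simp
    show "integrable M (\<lambda>\<omega>. Z k \<omega> * Z l \<omega>)"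
      using ex(4) by (subst integrable_cong_AE[OF _ _ eq]) auto
    show "expectation (\<lambda>\<omega>. Z k \<omega> * Z l \<omega>) = dot J (v k) (v l)"
      using ex(2) by (subst integral_cong_AE[OF _ _ eq]) auto
  qed
  have "box_assoc M {1..m} ?W i"
  proof (rule box_assoc_indep_std_normal[OF _ i J indep X])
    show "dot J (v k) (v l) \<le> 0" if "k \<in> {1..m}" "l \<in> {1..m}" "k \<noteq> l" for k l
      using A_cov cov that by metis
    show "0 \<le> (\<Sum>l\<in>{1..m}. dot J (v k) (v l))" if k: "k \<in> {1..m}" for k
    proof -
      \<comment> \<open>Integrability of the products lets the expectation distribute over the sum,
        which turns (B) into a row sum of the Gram matrix.\<close>
      have "expectation (\<lambda>\<omega>. Z k \<omega> * (\<Sum>l=1..m. Z l \<omega>)) = (\<Sum>l=1..m. dot J (v k) (v l))"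
        using int cov k by (simp add: sum_distrib_left)
      then show ?thesis using B k by metis
    qed
  qed auto
  then have assoc: "box_assoc M {1..m} Z i"
    using Z i by (subst box_assoc_cong_AE) auto
  show "positively_associated_given M (\<lambda>\<omega>. (\<Sum>j=1..m. Z j \<omega>) / real m) (Z i) (box_events M m Z)"
    unfolding positively_associated_given_def
  proof (intro allI ballI impI)
    fix s t C assume "C \<in> box_events M m Z" and pos: "0 < prob C"
    then obtain a b where "C = {\<omega> \<in> space M. \<forall>i\<in>{1..m}. a i \<le> ereal (Z i \<omega>) \<and> ereal (Z i \<omega>) \<le> b i}"
      unfolding box_events_def by blast
    then have C: "C = {\<omega> \<in> space M. in_box {1..m} a b (\<lambda>k. Z k \<omega>)}"
      by (simp add: in_box_def)
    \<comment> \<open>Membership of \<open>i\<close> in \<open>{1..m}\<close> gives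
      \<open>m > 0\<close>, so the average is compared with \<open>s\<close> by rescaling the
      threshold for the sum.\<close>
    have mean: "s \<le> (\<Sum>j=1..m. Z j \<omega>) / real m \<longleftrightarrow> s * real m \<le> (\<Sum>j=1..m. Z j \<omega>)" for \<omega>
      using i by (simp add: le_divide_eq)
    let ?C = "\<lambda>\<omega>. in_box {1..m} a b (\<lambda>k. Z k \<omega>)"
    have "\<P>(\<omega> in M. ?C \<omega> \<and> s * real m \<le> (\<Sum>j=1..m. Z j \<omega>)) * \<P>(\<omega> in M. ?C \<omega> \<and> Z i \<omega> \<in> {t..})
       \<le> \<P>(\<omega> in M. ?C \<omega> \<and> s * real m \<le> (\<Sum>j=1..m. Z j \<omega>) \<and> Z i \<omega> \<in> {t..}) * \<P>(\<omega> in M. ?C \<omega>)"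
      by (rule box_assocD[OF assoc]) (auto simp: up_closed_def)
    \<comment> \<open>Division by the square of \<open>prob C\<close> turns the cross-multiplied
      form into conditional probabilities.\<close>
    moreover have "x / d * (y / d) \<le> z / d" if "x * y \<le> z * d" "0 < d" for x y z d :: real
      using that by (simp add: field_simps)
    moreover have "{\<omega> \<in> space M. P \<omega> \<and> \<omega> \<in> C} = {\<omega> \<in> space M. ?C \<omega> \<and> P \<omega>}"
      "{\<omega> \<in> space M. \<omega> \<in> C} = {\<omega> \<in> space M. ?C \<omega>}" for P
      unfolding C by auto
    ultimately show "\<P>(\<omega> in M. s \<le> (\<Sum>j=1..m. Z j \<omega>) / real m \<bar> \<omega> \<in> C) * \<P>(\<omega> in M. t \<le> Z i \<omega> \<bar> \<omega> \<in> C)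
      \<le> \<P>(\<omega> in M. s \<le> (\<Sum>j=1..m. Z j \<omega>) / real m \<and> t \<le> Z i \<omega> \<bar> \<omega> \<in> C)"
      using pos unfolding cond_prob_def mean by (simp only: C[symmetric] atLeast_iff)
  qed
qed

end
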